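(* Let $G=(V,E)$ be a finite undirected unweighted graph, let $\pi:V\to\{1,\dots,|V|\}$ be a vertex order (a bijection), and let $V$ be split into $T$ equal-size batches as in the algorithm BVC-PLL. Then BVC-PLL run on $(G,\pi)$ produces the canonical hierarchical hub labeling of $G$ with respect to $\pi$; that is, for all $u,v\in V$, in the final output $u\in L(v)$ if and only if $u$ and $v$ are connected in $G$ and $u$ has the highest rank in $P_{uv}$, i.e. there is no $w\in P_{uv}$ with $\pi(w)<\pi(u)$.
   Context: A smaller value of $\pi$ means a higher rank. For vertices $u,v$, $P_{uv}$ is the set of all vertices lying on shortest paths between $u$ and $v$ (including $u$ and $v$). The canonical hierarchical hub labeling for $\pi$ assigns to each vertex $v$ the label consisting of those vertices $u$ (connected to $v$) that have the highest rank in $P_{uv}$. Algorithm BVC-PLL. Each vertex $v$ holds a label $L(v)$ and a new label $\delta L(v)$ (finite sets of pairs (vertex, distance value)) and a set $C(v)$ of flagged vertices. We write $u\in L(v)$ if some pair $(u,d)$ is in $L(v)$; for $h\in L(v)$ the recorded value is written $d(h,v)=d(v,h)$. A minimum over the empty set is $+\infty$. Initially $L(v)=C(v)=\emptyset$ for all $v$. Split $V$ into equal-size batches $B_1,\dots,B_T$ ($T$ divides $|V|$), where $B_i$ consists of the vertices $v$ with $(i-1)|V|/T+1\le\pi(v)\le i|V|/T$. For $i=1,\dots,T$ in order, do: - Set ActiveVertices $=B_i$; for every $u\in B_i$ set $\delta L(u)=\{(u,0)\}$ and $L(u)\leftarrow L(u)\cup\delta L(u)$. - While ActiveVertices $\ne\emptyset$,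 perform one iteration, starting with empty message sets. Scatter: for every active vertex $a$, every edge $(a,v)$ and every $(u,d)\in\delta L(a)$, if $\pi(u)<\pi(v)$ and $u\notin C(v)$, then add $u$ to $C(v)$ and send the message $(u,d+1)$ to $v$ (test and flagging are atomic); afterwards set ActiveVertices $=\emptyset$. Gather: for every vertex $v$ that received a message in this iteration: set $\delta L(v)=\emptyset$; for each message $(u,d)$ received by $v$, perform the distance check $d<\min_{h\in L(u)\cap L(v)}\big(d(u,h)+d(h,v)\big)$ with the current labels and, if it holds, add $(u,d)$ to $\delta L(v)$; after all messages of $v$ are treated, if $\delta L(v)\neq\emptyset$, replace $L(v)$ by $L(v)\cup\delta L(v)$ and add $v$ to ActiveVertices. - Set $C(v)=\emptyset$ for all $v$. The output is the final $L$. *)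

theory Defs
  imports "Graph_Theory.Graph_Theory" "HOL-Library.Extended_Nat"
begin

section \<open>Canonical hierarchical hub labelings\<close>

definition shortest_path ::
  "('a, 'b) pre_digraph \<Rightarrow> 'a \<Rightarrow> 'b awalk \<Rightarrow> 'a \<Rightarrow> bool" where
  "shortest_path G u p v \<longleftrightarrow>
     pre_digraph.apath G u p v \<and>
     (\<forall>q. pre_digraph.apath G u q v \<longrightarrow> length p \<le> length q)"

definition sp_verts :: "('a, 'b) pre_digraph \<Rightarrow> 'a \<Rightarrow> 'a \<Rightarrow> 'a set" where
  "sp_verts G u v = {w. \<exists>p. shortest_path G u p v \<and> w \<in> set (pre_digraph.awalk_verts G u p)}"

text \<open>A smaller value of \<open>\<pi>\<close> means a higher rank.\<close>

definition canonical_hhl ::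
  "('a, 'b) pre_digraph \<Rightarrow> ('a \<Rightarrow> nat) \<Rightarrow> 'a \<Rightarrow> 'a set" where
  "canonical_hhl G \<pi> v =
     {u \<in> verts G. u \<rightarrow>\<^sup>*\<^bsub>G\<^esub> v \<and> \<not> (\<exists>w \<in> sp_verts G u v. \<pi> w < \<pi> u)}"

section \<open>The algorithm BVC-PLL\<close>

type_synonym 'a label = "('a \<times> nat) set"

definition hubs :: "'a label \<Rightarrow> 'a set" where
  "hubs A = fst ` A"

text \<open>
  The right-hand side of the distance check. A hub occurs with only one value in each label that
  the algorithm builds, so ranging over pairs is the same as ranging over common hubs. In
  \<^typ>\<open>enat\<close> the infimum of the empty set is \<open>\<infinity>\<close>.
\<close>

definition query :: "'a label \<Rightarrow> 'a label \<Rightarrow> enat" where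
  "query A B = Inf {enat (d1 + d2) | h d1 d2. (h, d1) \<in> A \<and> (h, d2) \<in> B}"

text \<open>The division below is exact when \<open>T\<close> divides the number of vertices.\<close>

definition batch ::
  "('a, 'b) pre_digraph \<Rightarrow> ('a \<Rightarrow> nat) \<Rightarrow> nat \<Rightarrow> nat \<Rightarrow> 'a set" where
  "batch G \<pi> T i =
     {v \<in> verts G. (i - 1) * card (verts G) div T + 1 \<le> \<pi> v \<and> \<pi> v \<le> i * card (verts G) div T}"

text \<open>
  The algorithm is a nondeterministic transition system, because the order in which the loops
  of the Scatter and Gather phases run through their (finite) index sets is left open.
  The first argument of \<open>While\<close>, \<open>Scatter\<close> and \<open>Gather\<close> is the number of the current batch.
  \<open>Scatter i W\<close> has still to process the work items \<open>(a, v, u, d)\<close> in \<open>W\<close>: active vertex \<open>a\<close>,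
  edge \<open>(a, v)\<close> and pair \<open>(u, d)\<close> in the new label of \<open>a\<close>.
  \<open>Gather i W R\<close> has still to start on the vertices in \<open>W\<close>, and those in \<open>R\<close> are in progress.
  More than one vertex may be in progress, so vertices can be treated one after the other in any
  order, but also concurrently.
\<close>

datatype 'a control =
    Batch nat
  | While nat
  | Scatter nat "('a \<times> 'a \<times> 'a \<times> nat) set"
  | Gather nat "'a set" "'a set"
  | Halt

text \<open>In the Gather phase, \<open>msgs v\<close> holds the messages received by \<open>v\<close> and not yet treated.\<close>

record 'a state =
  control :: "'a control"
  lab :: "'a \<Rightarrow> 'a label"
  new_lab :: "'a \<Rightarrow> 'a label"
  flagged :: "'a \<Rightarrow> 'a set"
  active :: "'a set"
  msgs :: "'a \<Rightarrow> ('a \<times> nat) set"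

definition init_state :: "'a state" where
  "init_state =
     \<lparr> control = Batch 1, lab = (\<lambda>_. {}), new_lab = (\<lambda>_. {}), flagged = (\<lambda>_. {}),
       active = {}, msgs = (\<lambda>_. {}) \<rparr>"

inductive bvc_pll_step ::
  "('a, 'b) pre_digraph \<Rightarrow> ('a \<Rightarrow> nat) \<Rightarrow> nat \<Rightarrow> 'a state \<Rightarrow> 'a state \<Rightarrow> bool"
  for G :: "('a, 'b) pre_digraph" and \<pi> :: "'a \<Rightarrow> nat" and T :: nat where
  begin_batch:
    "\<lbrakk> control s = Batch i; i \<le> T \<rbrakk> \<Longrightarrow>
     bvc_pll_step G \<pi> T s
       (s\<lparr> control := While i,
          active := batch G \<pi> T i,
          new_lab := (\<lambda>u. if u \<in> batch G \<pi> T i then {(u, 0)} else new_lab s u),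
          lab := (\<lambda>u. if u \<in> batch G \<pi> T i then lab s u \<union> {(u, 0)} else lab s u) \<rparr>)"
| halt:
    "\<lbrakk> control s = Batch i; \<not> i \<le> T \<rbrakk> \<Longrightarrow>
     bvc_pll_step G \<pi> T s (s\<lparr> control := Halt \<rparr>)"
| begin_iteration:
    "\<lbrakk> control s = While i; active s \<noteq> {} \<rbrakk> \<Longrightarrow>
     bvc_pll_step G \<pi> T s
       (s\<lparr> control := Scatter i {(a, v, u, d). a \<in> active s \<and> a \<rightarrow>\<^bsub>G\<^esub> v \<and> (u, d) \<in> new_lab s a},
          msgs := (\<lambda>_. {}) \<rparr>)"
| end_batch:
    "\<lbrakk> control s = While i; active s = {} \<rbrakk> \<Longrightarrow>
     bvc_pll_step G \<pi> T s (s\<lparr> control := Batch (i + 1), flagged := (\<lambda>_. {}) \<rparr>)"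
| scatter_send:
    "\<lbrakk> control s = Scatter i W; (a, v, u, d) \<in> W; \<pi> u < \<pi> v \<and> u \<notin> flagged s v \<rbrakk> \<Longrightarrow>
     bvc_pll_step G \<pi> T s
       (s\<lparr> control := Scatter i (W - {(a, v, u, d)}),
          flagged := (flagged s)(v := insert u (flagged s v)),
          msgs := (msgs s)(v := insert (u, d + 1) (msgs s v)) \<rparr>)"
| scatter_skip:
    "\<lbrakk> control s = Scatter i W; (a, v, u, d) \<in> W; \<not> (\<pi> u < \<pi> v \<and> u \<notin> flagged s v) \<rbrakk> \<Longrightarrow>
     bvc_pll_step G \<pi> T s (s\<lparr> control := Scatter i (W - {(a, v, u, d)}) \<rparr>)"
| end_scatter:
    "\<lbrakk> control s = Scatter i {} \<rbrakk> \<Longrightarrow>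
     bvc_pll_step G \<pi> T s (s\<lparr> control := Gather i {v. msgs s v \<noteq> {}} {}, active := {} \<rparr>)"
| gather_start:
    "\<lbrakk> control s = Gather i W R; v \<in> W \<rbrakk> \<Longrightarrow>
     bvc_pll_step G \<pi> T s
       (s\<lparr> control := Gather i (W - {v}) (insert v R), new_lab := (new_lab s)(v := {}) \<rparr>)"
| gather_message:
    "\<lbrakk> control s = Gather i W R; v \<in> R; (u, d) \<in> msgs s v \<rbrakk> \<Longrightarrow>
     bvc_pll_step G \<pi> T s
       (s\<lparr> msgs := (msgs s)(v := msgs s v - {(u, d)}),
          new_lab := (new_lab s)(v :=
            (if enat d < query (lab s u) (lab s v)
             then insert (u, d) (new_lab s v) else new_lab s v)) \<rparr>)"
| gather_finish:
    "\<lbrakk> control s = Gather i W R; v \<in> R; msgs s v = {} \<rbrakk> \<Longrightarrow>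
     bvc_pll_step G \<pi> T s
       (if new_lab s v \<noteq> {}
        then s\<lparr> control := Gather i W (R - {v}),
               lab := (lab s)(v := lab s v \<union> new_lab s v),
               active := insert v (active s) \<rparr>
        else s\<lparr> control := Gather i W (R - {v}) \<rparr>)"
| end_gather:
    "\<lbrakk> control s = Gather i {} {} \<rbrakk> \<Longrightarrow>
     bvc_pll_step G \<pi> T s (s\<lparr> control := While i \<rparr>)"

definition bvc_pll_reachable ::
  "('a, 'b) pre_digraph \<Rightarrow> ('a \<Rightarrow> nat) \<Rightarrow> nat \<Rightarrow> 'a state \<Rightarrow> bool" where
  "bvc_pll_reachable G \<pi> T s \<longleftrightarrow> (bvc_pll_step G \<pi> T)\<^sup>*\<^sup>* init_state s"

text \<open>Every execution ends, and it ends by halting: there is no infinite run and no deadlock.\<close>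

definition bvc_pll_terminates ::
  "('a, 'b) pre_digraph \<Rightarrow> ('a \<Rightarrow> nat) \<Rightarrow> nat \<Rightarrow> bool" where
  "bvc_pll_terminates G \<pi> T \<longleftrightarrow>
     \<not> (\<exists>r. r 0 = init_state \<and> (\<forall>n. bvc_pll_step G \<pi> T (r n) (r (Suc n)))) \<and>
     (\<forall>s. bvc_pll_reachable G \<pi> T s \<and> \<not> (\<exists>s'. bvc_pll_step G \<pi> T s s') \<longrightarrow> control s = Halt)"

definition bvc_pll_output ::
  "('a, 'b) pre_digraph \<Rightarrow> ('a \<Rightarrow> nat) \<Rightarrow> nat \<Rightarrow> ('a \<Rightarrow> 'a label) \<Rightarrow> bool" where
  "bvc_pll_output G \<pi> T L \<longleftrightarrow>
     (\<exists>s. bvc_pll_reachable G \<pi> T s \<and> control s = Halt \<and> L = lab s)"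

end

theory Submission
  imports Defs
begin

text \<open>
  All messages of the \<open>k\<close>-th iteration of a batch carry distance \<open>k\<close>. When a message \<open>(u, k)\<close> is
  checked at \<open>v\<close>, all canonical pairs with hubs from earlier batches, and those with hubs from the
  current batch and distance less than \<open>k\<close>, are present, and everything present is canonical.
  Let \<open>h\<close> be the vertex of highest rank in \<open>P\<^sub>u\<^sub>v\<close>. If \<open>(u, k)\<close> is not canonical for \<open>v\<close>, then the
  distances of \<open>h\<close> from \<open>u\<close> and \<open>v\<close> are less than \<open>k\<close>, so \<open>h\<close> is in both labels already and the
  distance check fails. This holds even if \<open>h\<close> is in the same batch as \<open>u\<close>, and even if \<open>u\<close> has
  already finished its own Gather step. Conversely, a canonical pair is propagated along a shortest
  path, on all vertices of which its hub is canonical too.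
\<close>

section \<open>Shortest paths and relation powers\<close>

context wf_digraph
begin

text \<open>Distances are handled below as exponents of \<open>arcs_ends G\<close>, so that joining
  and splitting walks become facts about relation powers. For \<open>n = 0\<close> the empty walk
  requires a vertex, while the identity relation covers the whole type.\<close>

lemma awalk_length_iff_relpow:
  "u \<in> verts G \<Longrightarrow> (\<exists>p. awalk u p v \<and> length p = n) \<longleftrightarrow> (u, v) \<in> arcs_ends G ^^ n"
proof (induction n arbitrary: u)
  case 0
  then show ?case by (auto simp: awalk_Nil_iff)
next
  case (Suc n)
  show ?case
  proof
    assume "\<exists>p. awalk u p v \<and> length p = Suc n"
    then obtain e p where "awalk u (e # p) v" "length p = n"
      by (auto simp: length_Suc_conv)
    then have *: "e \<in> arcs G" "tail G e = u" "awalk (head G e) p v"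
      by (auto simp: awalk_Cons_iff)
    with Suc.IH[of "head G e"] \<open>length p = n\<close> have "(head G e, v) \<in> arcs_ends G ^^ n"
      using awalk_hd_in_verts by blast
    moreover have "(u, head G e) \<in> arcs_ends G"
      using * by (auto simp: arcs_ends_conv)
    ultimately show "(u, v) \<in> arcs_ends G ^^ Suc n"
      by (rule relpow_Suc_I2[rotated])
  next
    assume "(u, v) \<in> arcs_ends G ^^ Suc n"
    then obtain w where w: "(u, w) \<in> arcs_ends G" "(w, v) \<in> arcs_ends G ^^ n"
      by (meson relpow_Suc_D2)
    moreover have "w \<in> verts G" using w adj_in_verts by blast
    ultimately obtain p where "awalk w p v" "length p = n" using Suc.IH by blast
    moreover from w obtain e where "e \<in> arcs G" "tail G e = u" "head G e = w"
      by (auto simp: arcs_ends_conv)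
    ultimately have "awalk u (e # p) v \<and> length (e # p) = Suc n"
      by (simp add: awalk_Cons_iff)
    then show "\<exists>p. awalk u p v \<and> length p = Suc n" ..
  qed
qed

lemma awalk_imp_relpow: "awalk u p v \<Longrightarrow> (u, v) \<in> arcs_ends G ^^ length p"
  using awalk_length_iff_relpow[OF awalk_hd_in_verts, of u p v v "length p"] by auto

lemma relpow_imp_awalk:
  assumes "(u, v) \<in> arcs_ends G ^^ n" "u \<in> verts G"
  obtains p where "awalk u p v" "length p = n"
  using awalk_length_iff_relpow[OF assms(2), of v n] assms(1) by auto

lemma apath_no_longer_than_awalk:
  "awalk u p v \<Longrightarrow> \<exists>q. apath u q v \<and> length q \<le> length p"
proof (induction p rule: length_induct)
  case (1 p)
  show ?case
  proof (cases "distinct (awalk_verts u p)")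
    case True
    with 1 show ?thesis by (auto simp: apath_def)
  next
    case False
    then obtain q r s where p: "p = q @ r @ s" "0 < length r"
      and "\<exists>w. awalk u q w \<and> awalk w r w \<and> awalk w s v"
      using awalk_not_distinct_decomp[OF 1(2)] by blast
    then have "awalk u (q @ s) v" by auto
    moreover have "length (q @ s) < length p" using p by simp
    ultimately obtain q' where "apath u q' v" "length q' \<le> length (q @ s)"
      using 1(1) by blast
    with p show ?thesis by (intro exI[of _ q']) simp
  qed
qed

text \<open>\<open>shortest_path\<close> minimises over simple paths. Cutting out a cycle shortens a
  walk, so the minimum over all walks is the same and is attained without repeated vertices.\<close>

lemma shortest_path_iff:
  assumes "u \<in> verts G"
  shows "shortest_path G u p v \<longleftrightarrow> awalk u p v \<and> (\<forall>m < length p. (u, v) \<notin> arcs_ends G ^^ m)"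
proof
  assume p: "shortest_path G u p v"
  then have "awalk u p v" by (auto simp: shortest_path_def apath_def)
  moreover have "(u, v) \<notin> arcs_ends G ^^ m" if "m < length p" for m
  proof
    assume "(u, v) \<in> arcs_ends G ^^ m"
    then obtain q where "awalk u q v" "length q = m"
      using relpow_imp_awalk[OF _ assms] by blast
    with p that show False
      using apath_no_longer_than_awalk[of u q v] by (force simp: shortest_path_def)
  qed
  ultimately show "awalk u p v \<and> (\<forall>m < length p. (u, v) \<notin> arcs_ends G ^^ m)" by blast
next
  assume *: "awalk u p v \<and> (\<forall>m < length p. (u, v) \<notin> arcs_ends G ^^ m)"
  then have p: "awalk u p v" ..
  have min: "length p \<le> length q" if "awalk u q v" for q
    using awalk_imp_relpow[OF that] * by (metis not_less)
  have "distinct (awalk_verts u p)"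
  proof (rule ccontr)
    assume "\<not> distinct (awalk_verts u p)"
    then obtain q r s where "p = q @ r @ s" "0 < length r"
      "\<exists>w. awalk u q w \<and> awalk w r w \<and> awalk w s v"
      using awalk_not_distinct_decomp[OF p] by blast
    with min[of "q @ s"] show False by auto
  qed
  with p min show "shortest_path G u p v"
    by (auto simp: shortest_path_def apath_def)
qed

lemma sp_verts_iff:
  assumes "u \<in> verts G"
  shows "w \<in> sp_verts G u v \<longleftrightarrow>
    (\<exists>m n. (u, w) \<in> arcs_ends G ^^ m \<and> (w, v) \<in> arcs_ends G ^^ n \<and>
      (\<forall>k < m + n. (u, v) \<notin> arcs_ends G ^^ k))"
proof
  assume "w \<in> sp_verts G u v"
  then obtain p where "shortest_path G u p v" and w: "w \<in> set (awalk_verts u p)"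
    unfolding sp_verts_def by blast
  then have p: "awalk u p v" "\<forall>m < length p. (u, v) \<notin> arcs_ends G ^^ m"
    unfolding shortest_path_iff[OF assms] by simp_all
  then obtain q r where qr: "p = q @ r" "awalk u q w" "awalk w r v"
    using awalk_decomp[OF p(1) w] by blast
  then have "(u, w) \<in> arcs_ends G ^^ length q" "(w, v) \<in> arcs_ends G ^^ length r"
    by (simp_all add: awalk_imp_relpow)
  with p qr show "\<exists>m n. (u, w) \<in> arcs_ends G ^^ m \<and> (w, v) \<in> arcs_ends G ^^ n \<and>
      (\<forall>k < m + n. (u, v) \<notin> arcs_ends G ^^ k)"
    by (intro exI[of _ "length q"] exI[of _ "length r"]) simp
next
  assume "\<exists>m n. (u, w) \<in> arcs_ends G ^^ m \<and> (w, v) \<in> arcs_ends G ^^ n \<and>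
      (\<forall>k < m + n. (u, v) \<notin> arcs_ends G ^^ k)"
  then obtain m n where mn: "(u, w) \<in> arcs_ends G ^^ m" "(w, v) \<in> arcs_ends G ^^ n"
    "\<forall>k < m + n. (u, v) \<notin> arcs_ends G ^^ k"
    by blast
  obtain q where q: "awalk u q w" "length q = m"
    using relpow_imp_awalk[OF mn(1) assms] .
  obtain r where r: "awalk w r v" "length r = n"
    using relpow_imp_awalk[OF mn(2) awalk_last_in_verts[OF q(1)]] .
  have "awalk u (q @ r) v" using q r by auto
  then have "shortest_path G u (q @ r) v"
    using mn q r unfolding shortest_path_iff[OF assms] by simp
  moreover have "w \<in> set (awalk_verts u (q @ r))"
    using set_awalk_verts_append[OF q(1) r(1)] hd_in_awalk_verts(1)[OF r(1)] by auto
  ultimately show "w \<in> sp_verts G u v"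
    unfolding sp_verts_def by blast
qed

lemma reachable_iff_relpow:
  assumes "u \<in> verts G"
  shows "u \<rightarrow>\<^sup>*\<^bsub>G\<^esub> v \<longleftrightarrow> (\<exists>n. (u, v) \<in> arcs_ends G ^^ n)"
  by (simp add: reachable_awalk awalk_length_iff_relpow[OF assms, symmetric])

end

section \<open>Canonical hubs\<close>

locale ranked_graph = graph G for G :: "('a, 'b) pre_digraph" +
  fixes \<pi> :: "'a \<Rightarrow> nat"
  assumes rank_bij: "bij_betw \<pi> (verts G) {1..card (verts G)}"
begin

abbreviation wlk :: "nat \<Rightarrow> 'a \<Rightarrow> 'a \<Rightarrow> bool" where
  "wlk n u v \<equiv> (u, v) \<in> arcs_ends G ^^ n"

lemma wlk_sym: "wlk n u v \<Longrightarrow> wlk n v u"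
proof (induction n arbitrary: v)
  case (Suc n)
  then obtain w where "wlk n w u" "(w, v) \<in> arcs_ends G" by auto
  moreover then have "(v, w) \<in> arcs_ends G" using arcs_ends_symmetric[OF sym_arcs] by simp
  ultimately show ?case by (meson relpow_Suc_I2)
qed simp

lemma wlk_trans: "wlk m u w \<Longrightarrow> wlk n w v \<Longrightarrow> wlk (m + n) u v"
  unfolding relpow_add by (rule relcompI)

lemma wlk_in_verts: "wlk n u v \<Longrightarrow> u \<in> verts G \<Longrightarrow> v \<in> verts G"
  by (cases n) (simp, metis adj_in_verts(2) relpow_Suc_E)

text \<open>Vertex \<open>u\<close> has distance \<open>n\<close> from \<open>v\<close> and the highest rank in \<open>P\<^sub>u\<^sub>v\<close>.\<close>

definition hub_at :: "nat \<Rightarrow> 'a \<Rightarrow> 'a \<Rightarrow> bool" where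
  "hub_at n u v \<longleftrightarrow> u \<in> verts G \<and> wlk n u v \<and> (\<forall>m<n. \<not> wlk m u v) \<and>
     (\<forall>m l w. wlk m u w \<longrightarrow> wlk l w v \<longrightarrow> m + l = n \<longrightarrow> \<pi> u \<le> \<pi> w)"

lemma hub_atD:
  assumes "hub_at n u v"
  shows "u \<in> verts G" "v \<in> verts G" "wlk n u v" "\<And>m. wlk m u v \<Longrightarrow> n \<le> m"
    "\<And>m l w. wlk m u w \<Longrightarrow> wlk l w v \<Longrightarrow> m + l = n \<Longrightarrow> \<pi> u \<le> \<pi> w"
proof -
  show u: "u \<in> verts G" and n: "wlk n u v" using assms by (simp_all add: hub_at_def)
  show "v \<in> verts G" using u n by (rule wlk_in_verts[rotated])
  show "n \<le> m" if "wlk m u v" for m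
    using assms that by (auto simp: hub_at_def not_less[symmetric])
  show "\<pi> u \<le> \<pi> w" if "wlk m u w" "wlk l w v" "m + l = n" for m l w
    using assms that unfolding hub_at_def by blast
qed

lemma canonical_hhl_iff:
  "u \<in> canonical_hhl G \<pi> v \<longleftrightarrow> (\<exists>n. hub_at n u v)"
proof (cases "u \<in> verts G")
  case True
  show ?thesis
  proof
    assume "u \<in> canonical_hhl G \<pi> v"
    then have "\<exists>n. wlk n u v" and max: "\<And>w. w \<in> sp_verts G u v \<Longrightarrow> \<pi> u \<le> \<pi> w"
      using reachable_iff_relpow[OF True] by (auto simp: canonical_hhl_def not_less)
    then obtain n where "wlk n u v" "\<forall>m<n. \<not> wlk m u v"
      using exists_least_iff[of "\<lambda>n. wlk n u v"] by blast
    then have "hub_at n u v"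
      using max sp_verts_iff[OF True] True unfolding hub_at_def by blast
    then show "\<exists>n. hub_at n u v" ..
  next
    assume "\<exists>n. hub_at n u v"
    then obtain n where n: "hub_at n u v" ..
    have "\<pi> u \<le> \<pi> w" if w: "w \<in> sp_verts G u v" for w
    proof -
      obtain m l where ml: "wlk m u w" "wlk l w v" "\<forall>k < m + l. \<not> wlk k u v"
        using w sp_verts_iff[OF True] by blast
      \<comment> \<open>The walk through \<open>w\<close> has length \<open>m + l\<close>, and
        neither it nor the one of length \<open>n\<close> can be undercut.\<close>
      then have "m + l = n"
        using hub_atD(3,4)[OF n] wlk_trans[OF ml(1,2)] by (meson le_antisym not_less)
      with ml hub_atD(5)[OF n] show ?thesis by blast
    qed
    then show "u \<in> canonical_hhl G \<pi> v"
      using True hub_atD(3)[OF n] reachable_iff_relpow[OF True]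
      by (auto simp: canonical_hhl_def not_less)
  qed
qed (auto simp: canonical_hhl_def hub_at_def)

lemma rank_eq: "u \<in> verts G \<Longrightarrow> v \<in> verts G \<Longrightarrow> \<pi> u = \<pi> v \<Longrightarrow> u = v"
  using rank_bij by (auto simp: bij_betw_def inj_on_def)

lemma rank_le_card: "u \<in> verts G \<Longrightarrow> \<pi> u \<le> card (verts G)"
  and rank_pos: "u \<in> verts G \<Longrightarrow> 0 < \<pi> u"
  using bij_betwE[OF rank_bij] by fastforce+

lemma hub_at_0 [simp]: "hub_at 0 u v \<longleftrightarrow> u = v \<and> u \<in> verts G"
  by (auto simp: hub_at_def)

lemma hub_at_unique: "hub_at m u v \<Longrightarrow> hub_at n u v \<Longrightarrow> m = n"
  by (meson hub_atD(3,4) le_antisym)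

text \<open>At positive distance \<open>v\<close> is a vertex of P_uv other than \<open>u\<close>,
  and ranks are injective. Hence the rank test of Scatter never stops a canonical pair.\<close>

lemma hub_at_rank_less:
  assumes "hub_at (Suc n) u v"
  shows "\<pi> u < \<pi> v"
proof -
  have "\<pi> u \<le> \<pi> v"
    by (rule hub_atD(5)[OF assms hub_atD(3)[OF assms], where l = 0]) simp_all
  moreover have "u \<noteq> v" using hub_atD(4)[OF assms, of 0] by force
  then have "\<pi> u \<noteq> \<pi> v" using rank_eq hub_atD(1,2)[OF assms] by blast
  ultimately show ?thesis by simp
qed

text \<open>For the predecessor \<open>a\<close> of \<open>v\<close> on a shortest path, P_ua is
  contained in P_uv, so \<open>u\<close> has the highest rank there too.\<close>

lemma hub_at_pred:
  assumes "hub_at (Suc n) u v"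
  obtains a where "hub_at n u a" "(a, v) \<in> arcs_ends G"
proof -
  note D = hub_atD[OF assms]
  obtain a where a: "wlk n u a" "(a, v) \<in> arcs_ends G"
    using D(3) by auto
  have 1: "wlk (Suc m) w v" if "wlk m w a" for m w
    using that a by auto
  have "hub_at n u a"
    unfolding hub_at_def
  proof (intro conjI allI impI)
    show "\<not> wlk m u a" if "m < n" for m
      using D(4)[of "Suc m"] 1 that by force
    show "\<pi> u \<le> \<pi> w" if "wlk m u w" "wlk l w a" "m + l = n" for m l w
      using D(5)[where m = m and w = w and l = "Suc l"] 1 that by force
  qed (use a D in auto)
  with a that show thesis by blast
qed

text \<open>The witness \<open>h\<close> is the vertex of highest rank in \<open>P\<^sub>u\<^sub>v\<close>.\<close>

lemma common_hub:
  assumes "u \<in> verts G" "wlk n u v" "\<forall>m<n. \<not> wlk m u v"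
  obtains h m l where "hub_at m h u" "hub_at l h v" "m + l = n" "\<pi> h \<le> \<pi> u"
proof -
  \<comment> \<open>\<open>P\<close> is membership in P_uv. A minimum of \<pi> on it is also one on
    P_hu and P_hv, since both are contained in P_uv.\<close>
  define P where "P = (\<lambda>w. \<exists>m l. wlk m u w \<and> wlk l w v \<and> m + l = n)"
  have "P u" unfolding P_def using assms by (intro exI[of _ 0] exI[of _ n]) auto
  then obtain h where "P h" and min: "\<And>w. P w \<Longrightarrow> \<pi> h \<le> \<pi> w"
    using ex_has_least_nat[of P u \<pi>] by blast
  then obtain m l where ml: "wlk m u h" "wlk l h v" "m + l = n" unfolding P_def by blast
  have h: "h \<in> verts G" using wlk_in_verts[OF ml(1) assms(1)] .
  have "hub_at m h u"
    unfolding hub_at_def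
  proof (intro conjI allI impI)
    show "wlk m h u" using ml(1) by (rule wlk_sym)
    show "\<not> wlk k h u" if "k < m" for k
    proof
      assume "wlk k h u"
      then have "wlk k u h" by (rule wlk_sym)
      then have "wlk (k + l) u v" using ml(2) by (rule wlk_trans)
      with assms(3) ml that show False by auto
    qed
    show "\<pi> h \<le> \<pi> w" if "wlk k h w" "wlk j w u" "k + j = m" for k j w
    proof (rule min)
      have "wlk j u w" using that(2) by (rule wlk_sym)
      moreover have "wlk k w h" using that(1) by (rule wlk_sym)
      then have "wlk (k + l) w v" using ml(2) by (rule wlk_trans)
      ultimately have "wlk j u w" "wlk (k + l) w v" .
      with that ml show "P w" unfolding P_def by (intro exI[of _ j] exI[of _ "k + l"]) auto
    qed
  qed (use h in auto)
  moreover have "hub_at l h v"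
    unfolding hub_at_def
  proof (intro conjI allI impI)
    show "wlk l h v" using ml by blast
    show "\<not> wlk k h v" if "k < l" for k
    proof
      assume "wlk k h v"
      with ml(1) have "wlk (m + k) u v" by (rule wlk_trans)
      with assms(3) ml that show False by auto
    qed
    show "\<pi> h \<le> \<pi> w" if "wlk k h w" "wlk j w v" "k + j = l" for k j w
    proof (rule min)
      have "wlk (m + k) u w" using ml(1) that(1) by (rule wlk_trans)
      with that ml show "P w" unfolding P_def by (intro exI[of _ "m + k"] exI[of _ j]) auto
    qed
  qed (use h in auto)
  ultimately show thesis using that ml min[OF \<open>P u\<close>] by blast
qed

section \<open>The distance check as a test for canonical pairs\<close>

lemma less_query_iff:
  "enat k < query A B \<longleftrightarrow> (\<forall>h m l. (h, m) \<in> A \<longrightarrow> (h, l) \<in> B \<longrightarrow> k < m + l)"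
proof
  assume less: "enat k < query A B"
  show "\<forall>h m l. (h, m) \<in> A \<longrightarrow> (h, l) \<in> B \<longrightarrow> k < m + l"
  proof (intro allI impI)
    fix h m l
    assume "(h, m) \<in> A" "(h, l) \<in> B"
    then have "query A B \<le> enat (m + l)"
      unfolding query_def by (intro Inf_lower) blast
    with less have "enat k < enat (m + l)" by (rule less_le_trans)
    then show "k < m + l" by simp
  qed
next
  assume "\<forall>h m l. (h, m) \<in> A \<longrightarrow> (h, l) \<in> B \<longrightarrow> k < m + l"
  \<comment> \<open>A strict bound on all elements need not survive an infimum; here it amounts to
    the non-strict bound \<open>Suc k\<close>, which does.\<close>
  then have "enat (Suc k) \<le> query A B"
    unfolding query_def by (intro Inf_greatest) (auto simp: Suc_le_eq)
  then show "enat k < query A B"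
    using less_le_trans[of "enat k" "enat (Suc k)"] by simp
qed

text \<open>
  Content of the label of \<open>v\<close> when the hubs of rank at most \<open>b\<close> are complete, and those of the
  current batch, with ranks in \<open>{b<..c}\<close>, are complete for distances below \<open>k\<close>.
\<close>

definition labels_upto :: "nat \<Rightarrow> nat \<Rightarrow> nat \<Rightarrow> 'a \<Rightarrow> 'a label" where
  "labels_upto b c k v = {(h, d). hub_at d h v \<and> (\<pi> h \<le> b \<or> \<pi> h \<le> c \<and> d < k)}"

text \<open>One distance layer of the current batch: the new labels after a Gather phase, and the
  growth of \<open>labels_upto\<close> when \<open>k\<close> rises by one.\<close>

definition labels_at :: "nat \<Rightarrow> nat \<Rightarrow> nat \<Rightarrow> 'a \<Rightarrow> 'a label" where
  "labels_at b c k v = {(h, d). d = k \<and> hub_at k h v \<and> b < \<pi> h \<and> \<pi> h \<le> c}"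

text \<open>\<open>A\<close> stands for the label of \<open>u\<close>, which lies between two stages
  because \<open>u\<close> may or may not have finished its own Gather step; \<open>v\<close> is
  still at the earlier stage. \<open>k\<close> is the length of some walk and may exceed the
  distance.\<close>

lemma distance_check_iff:
  assumes "u \<in> verts G" "wlk k u v" "\<pi> u < \<pi> v" "b < \<pi> u" "\<pi> u \<le> c"
    and A: "labels_upto b c k u \<subseteq> A" "A \<subseteq> labels_upto b c (Suc k) u"
  shows "enat k < query A (labels_upto b c k v) \<longleftrightarrow> hub_at k u v"
proof
  assume check: "enat k < query A (labels_upto b c k v)"
  show "hub_at k u v"
  proof (rule ccontr)
    assume not_hub: "\<not> hub_at k u v"
    obtain n where n: "wlk n u v" "\<forall>m<n. \<not> wlk m u v"
      using exists_least_iff[of "\<lambda>n. wlk n u v"] assms(2) by blast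
    then obtain h m l where h: "hub_at m h u" "hub_at l h v" "m + l = n" "\<pi> h \<le> \<pi> u"
      using common_hub[OF assms(1) n] by metis
    have "n \<le> k" using n(2) assms(2) not_less by blast
    \<comment> \<open>\<open>m = 0\<close> means \<open>h = u\<close>; with \<open>n = k\<close>
      this would make \<open>u\<close> canonical for \<open>v\<close> at distance
      \<open>k\<close>.\<close>
    have "m \<noteq> 0"  if "n = k"
    proof
      assume "m = 0"
      with h that not_hub show False by auto
    qed
    \<comment> \<open>\<open>l = 0\<close> means \<open>h = v\<close>, but \<open>h\<close> ranks at
      least as high as \<open>u\<close>, and \<open>u\<close> higher than \<open>v\<close>.\<close>
    moreover have "l \<noteq> 0"
    proof
      assume "l = 0"
      with h assms(3) show False by auto
    qed
    ultimately have "m < k" "l < k" using h(3) \<open>n \<le> k\<close> by linarith+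
    then have "(h, m) \<in> A" "(h, l) \<in> labels_upto b c k v"
      using h A(1) assms(5) by (auto simp: labels_upto_def)
    with check have "k < m + l" unfolding less_query_iff by blast
    with h(3) \<open>n \<le> k\<close> show False by simp
  qed
next
  assume hub: "hub_at k u v"
  show "enat k < query A (labels_upto b c k v)"
    unfolding less_query_iff
  proof (intro allI impI)
    fix h m l
    assume "(h, m) \<in> A" and l: "(h, l) \<in> labels_upto b c k v"
    then have m: "hub_at m h u" and hl: "hub_at l h v"
      using A(2) by (auto simp: labels_upto_def)
    have uh: "wlk m u h" "wlk l h v"
      by (rule wlk_sym[OF hub_atD(3)[OF m]], rule hub_atD(3)[OF hl])
    show "k < m + l"
    proof (rule ccontr)
      \<comment> \<open>A common hub this close lies on a shortest path, so the ranks of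
        \<open>u\<close> and \<open>h\<close> bound each other and \<open>h = u\<close>. But
        \<open>(u, k)\<close> is not yet in the label of \<open>v\<close>: the current batch is
        complete only below \<open>k\<close>.\<close>
      assume "\<not> k < m + l"
      then have "m + l = k"
        using hub_atD(4)[OF hub wlk_trans[OF uh]] by simp
      then have "\<pi> u \<le> \<pi> h" using hub_atD(5)[OF hub uh] by simp
      moreover have "\<pi> h \<le> \<pi> u"
        using hub_atD(5)[OF m hub_atD(3)[OF m], where l = 0] by simp
      ultimately have "h = u"
        by (intro rank_eq hub_atD(1)[OF m] hub_atD(1)[OF hub]) simp
      with hl hub have "l = k" using hub_at_unique by blast
      with l \<open>h = u\<close> assms(4) show False by (simp add: labels_upto_def)
    qed
  qed
qed

section \<open>Growth of the labels by distance layers\<close>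

lemma labels_upto_Suc: "labels_upto b c (Suc k) v = labels_upto b c k v \<union> labels_at b c k v"
  by (auto simp: labels_upto_def labels_at_def less_Suc_eq)

lemma labels_at_zero: "labels_at b c 0 v = (if v \<in> verts G \<and> b < \<pi> v \<and> \<pi> v \<le> c then {(v, 0)} else {})"
  by (auto simp: labels_at_def)

lemma labels_upto_zero: "labels_upto b c 0 = labels_upto b b 0"
  by (auto simp: labels_upto_def)

lemma hub_at_prefix: "hub_at (j + k) u v \<Longrightarrow> \<exists>a. hub_at k u a"
proof (induction j arbitrary: v)
  case (Suc j)
  from Suc.prems have "hub_at (Suc (j + k)) u v" by simp
  then obtain w where "hub_at (j + k) u w" by (rule hub_at_pred)
  then show ?case by (rule Suc.IH)
qed auto

text \<open>A batch may stop at the first empty layer: going back along a shortest path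
  (\<open>hub_at_prefix\<close>), a canonical pair at distance \<open>k\<close> or more yields one
  at distance exactly \<open>k\<close>.\<close>

lemma labels_upto_complete:
  assumes "\<And>v. labels_at b c k v = {}" "b \<le> c"
  shows "labels_upto b c (Suc k) = labels_upto c c 0"
proof -
  have "d < Suc k" if "hub_at d h v" "b < \<pi> h" "\<pi> h \<le> c" for h d v
  proof (rule ccontr)
    assume "\<not> d < Suc k"
    with that(1) have "hub_at ((d - k) + k) h v" by simp
    then obtain a where "hub_at k h a" using hub_at_prefix by blast
    with that(2,3) have "(h, k) \<in> labels_at b c k a" by (simp add: labels_at_def)
    with assms(1) show False by simp
  qed
  with assms(2) show ?thesis
    by (fastforce simp: labels_upto_def fun_eq_iff)
qed

text \<open>A walk of length \<open>k\<close> is asked for, not distance \<open>k\<close>: where the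
  shortest routes are blocked, a message can still arrive along a longer one.\<close>

definition candidates :: "nat \<Rightarrow> nat \<Rightarrow> nat \<Rightarrow> 'a \<Rightarrow> 'a label" where
  "candidates b c k v = {(u, d). d = k \<and> u \<in> verts G \<and> wlk k u v \<and> \<pi> u < \<pi> v \<and> b < \<pi> u \<and> \<pi> u \<le> c}"

lemma candidatesI:
  assumes "(u, k) \<in> labels_at b c k a" "(a, v) \<in> arcs_ends G" "\<pi> u < \<pi> v"
  shows "(u, Suc k) \<in> candidates b c (Suc k) v"
proof -
  have "hub_at k u a" using assms(1) by (simp add: labels_at_def)
  then have "u \<in> verts G" "wlk (Suc k) u v"
    using hub_atD(1,3) assms(2) by (blast, meson relpow_Suc_I)
  with assms show ?thesis by (simp add: labels_at_def candidates_def)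
qed

lemma candidates_in_verts: "x \<in> candidates b c k v \<Longrightarrow> v \<in> verts G"
  unfolding candidates_def using wlk_in_verts by blast

lemma finite_candidates: "finite (candidates b c k v)"
  by (rule finite_subset[of _ "verts G \<times> {k}"]) (auto simp: candidates_def)

lemma labels_at_pred:
  assumes "(u, d) \<in> labels_at b c (Suc k) v"
  obtains a where "d = Suc k" "(a, v) \<in> arcs_ends G" "(u, k) \<in> labels_at b c k a" "\<pi> u < \<pi> v"
proof -
  have h: "hub_at (Suc k) u v" using assms by (simp add: labels_at_def)
  from hub_at_pred[OF h] obtain a where "hub_at k u a" "(a, v) \<in> arcs_ends G" .
  with assms hub_at_rank_less[OF h] that show thesis by (simp add: labels_at_def)
qed

abbreviation rank_bound :: "nat \<Rightarrow> nat \<Rightarrow> nat" where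
  "rank_bound T i \<equiv> i * card (verts G) div T"

section \<open>The invariant\<close>

text \<open>
  The parameter \<open>k\<close> is the distance of the pairs in the new labels of the active vertices. Messages
  thus carry distance \<open>Suc k\<close> in \<open>scatter_inv b c k\<close>, but \<open>k\<close> in \<open>gather_inv b c k\<close>.
\<close>

definition while_inv :: "nat \<Rightarrow> nat \<Rightarrow> nat \<Rightarrow> 'a state \<Rightarrow> bool" where
  "while_inv b c k s \<longleftrightarrow>
     lab s = labels_upto b c (Suc k) \<and>
     active s = {v. labels_at b c k v \<noteq> {}} \<and>
     (\<forall>v \<in> active s. new_lab s v = labels_at b c k v) \<and>
     (\<forall>v. \<forall>u \<in> flagged s v. \<exists>m\<le>k. wlk m u v)"

definition work_items :: "nat \<Rightarrow> nat \<Rightarrow> nat \<Rightarrow> ('a \<times> 'a \<times> 'a \<times> nat) set" where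
  "work_items b c k = {(a, v, u, d). (a, v) \<in> arcs_ends G \<and> (u, d) \<in> labels_at b c k a}"

text \<open>A flag was set either in this iteration, so that the message is there, or in an earlier
  one, so that a shorter walk exists. A handled item that passes the rank test falls under the same
  alternative.\<close>

definition scatter_inv ::
  "nat \<Rightarrow> nat \<Rightarrow> nat \<Rightarrow> ('a \<times> 'a \<times> 'a \<times> nat) set \<Rightarrow> 'a state \<Rightarrow> bool" where
  "scatter_inv b c k W s \<longleftrightarrow>
     lab s = labels_upto b c (Suc k) \<and>
     W \<subseteq> work_items b c k \<and>
     (\<forall>(a, v, u, d) \<in> work_items b c k - W.
        \<pi> u < \<pi> v \<longrightarrow> (u, Suc k) \<in> msgs s v \<or> (\<exists>m\<le>k. wlk m u v)) \<and>
     (\<forall>v. \<forall>u \<in> flagged s v. (u, Suc k) \<in> msgs s v \<or> (\<exists>m\<le>k. wlk m u v)) \<and>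
     (\<forall>v. msgs s v \<subseteq> candidates b c (Suc k) v)"

text \<open>Vertices in \<open>W\<close> wait, those in \<open>R\<close> are in progress, and the
  others have finished or received nothing. Stating this per vertex allows each Gather transition to
  be checked at one vertex only.\<close>

definition gather_at ::
  "nat \<Rightarrow> nat \<Rightarrow> nat \<Rightarrow> 'a set \<Rightarrow> 'a set \<Rightarrow> 'a state \<Rightarrow> 'a \<Rightarrow> bool" where
  "gather_at b c k W R s v \<longleftrightarrow>
     msgs s v \<subseteq> candidates b c k v \<and>
     (v \<in> W \<union> R \<longrightarrow> lab s v = labels_upto b c k v \<and> v \<notin> active s) \<and>
     (v \<in> W \<longrightarrow> labels_at b c k v \<subseteq> msgs s v) \<and>
     (v \<in> R \<longrightarrow> new_lab s v \<subseteq> labels_at b c k v \<and> labels_at b c k v \<subseteq> msgs s v \<union> new_lab s v) \<and>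
     (v \<notin> W \<union> R \<longrightarrow>
        lab s v = labels_upto b c (Suc k) v \<and>
        (v \<in> active s \<longleftrightarrow> labels_at b c k v \<noteq> {}) \<and>
        (v \<in> active s \<longrightarrow> new_lab s v = labels_at b c k v))"

definition gather_inv ::
  "nat \<Rightarrow> nat \<Rightarrow> nat \<Rightarrow> 'a set \<Rightarrow> 'a set \<Rightarrow> 'a state \<Rightarrow> bool" where
  "gather_inv b c k W R s \<longleftrightarrow>
     W \<inter> R = {} \<and> W \<union> R \<subseteq> verts G \<and>
     (\<forall>v. gather_at b c k W R s v) \<and>
     (\<forall>v. \<forall>u \<in> flagged s v. \<exists>m\<le>k. wlk m u v)"

text \<open>\<open>k\<close> is existential because the state holds no iteration counter. The bound
  \<open>T + 1\<close> on \<open>i\<close> fixes the batch number on halting.\<close>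

definition bvc_pll_inv :: "nat \<Rightarrow> 'a state \<Rightarrow> bool" where
  "bvc_pll_inv T s \<longleftrightarrow> (case control s of
      Batch i \<Rightarrow> 1 \<le> i \<and> i \<le> T + 1 \<and> flagged s = (\<lambda>_. {}) \<and>
        lab s = labels_upto (rank_bound T (i - 1)) (rank_bound T (i - 1)) 0
    | While i \<Rightarrow> 1 \<le> i \<and> i \<le> T \<and>
        (\<exists>k. while_inv (rank_bound T (i - 1)) (rank_bound T i) k s)
    | Scatter i W \<Rightarrow> 1 \<le> i \<and> i \<le> T \<and>
        (\<exists>k. scatter_inv (rank_bound T (i - 1)) (rank_bound T i) k W s)
    | Gather i W R \<Rightarrow> 1 \<le> i \<and> i \<le> T \<and>
        (\<exists>k. gather_inv (rank_bound T (i - 1)) (rank_bound T i) k W R s)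
    | Halt \<Rightarrow> lab s = (\<lambda>v. {(h, d). hub_at d h v}))"

section \<open>Preservation of the invariant by the single transitions\<close>

lemma begin_batch_inv:
  assumes "flagged s = (\<lambda>_. {})" "lab s = labels_upto b b 0"
    and B: "B = {v \<in> verts G. b < \<pi> v \<and> \<pi> v \<le> c}"
  shows "while_inv b c 0 (s\<lparr> control := C, active := B,
          new_lab := (\<lambda>u. if u \<in> B then {(u, 0)} else new_lab s u),
          lab := (\<lambda>u. if u \<in> B then lab s u \<union> {(u, 0)} else lab s u) \<rparr>)"
  using assms(1,2) unfolding while_inv_def B
  by (auto simp: labels_upto_Suc labels_at_zero labels_upto_zero[of b c] fun_eq_iff)

lemma begin_iteration_inv:
  assumes "while_inv b c k s"
  shows "scatter_inv b c k {(a, v, u, d). a \<in> active s \<and> a \<rightarrow>\<^bsub>G\<^esub> v \<and> (u, d) \<in> new_lab s a}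
    (s\<lparr> control := C, msgs := (\<lambda>_. {}) \<rparr>)"
  using assms unfolding while_inv_def scatter_inv_def work_items_def by fastforce

lemma end_batch_inv:
  assumes "while_inv b c k s" "active s = {}" "b \<le> c"
  shows "lab s = labels_upto c c 0"
proof -
  have "lab s = labels_upto b c (Suc k)" "\<And>v. labels_at b c k v = {}"
    using assms unfolding while_inv_def by blast+
  with labels_upto_complete assms(3) show ?thesis by simp
qed

lemma scatter_send_inv:
  assumes inv: "scatter_inv b c k W s" and W: "(a, v, u, d) \<in> W" and "\<pi> u < \<pi> v"
  shows "scatter_inv b c k (W - {(a, v, u, d)})
       (s\<lparr> control := C,
          flagged := (flagged s)(v := insert u (flagged s v)),
          msgs := (msgs s)(v := insert (u, d + 1) (msgs s v)) \<rparr>)"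
proof -
  have work: "(u, k) \<in> labels_at b c k a" "(a, v) \<in> arcs_ends G" and d: "d = k"
    using inv W unfolding scatter_inv_def work_items_def labels_at_def by blast+
  note new = candidatesI[OF work assms(3)]
  have "(u', Suc k) \<in> ((msgs s)(v := insert (u, d + 1) (msgs s v))) v' \<or> (\<exists>m\<le>k. wlk m u' v')"
    if "(a', v', u', d') \<in> work_items b c k - (W - {(a, v, u, d)})" "\<pi> u' < \<pi> v'" for a' v' u' d'
  proof (cases "(a', v', u', d') \<in> W")
    case True
    with that d show ?thesis by auto
  next
    case False
    with that inv have "(u', Suc k) \<in> msgs s v' \<or> (\<exists>m\<le>k. wlk m u' v')"
      unfolding scatter_inv_def by blast
    then show ?thesis by auto
  qed
  moreover have "(u', Suc k) \<in> ((msgs s)(v := insert (u, d + 1) (msgs s v))) v' \<or> (\<exists>m\<le>k. wlk m u' v')"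
    if "u' \<in> ((flagged s)(v := insert u (flagged s v))) v'" for v' u'
  proof (cases "u' \<in> flagged s v'")
    case True
    with inv have "(u', Suc k) \<in> msgs s v' \<or> (\<exists>m\<le>k. wlk m u' v')"
      unfolding scatter_inv_def by blast
    then show ?thesis by auto
  next
    case False
    with that d show ?thesis by (auto split: if_splits)
  qed
  ultimately show ?thesis
    using inv new d unfolding scatter_inv_def by simp blast
qed

text \<open>A skipped item fails the rank test, and nothing is claimed of it, or meets a flag, whose
  clause supplies the alternative required of the item.\<close>

lemma scatter_skip_inv:
  assumes inv: "scatter_inv b c k W s" and "\<not> (\<pi> u < \<pi> v \<and> u \<notin> flagged s v)"
  shows "scatter_inv b c k (W - {(a, v, u, d)}) (s\<lparr> control := C \<rparr>)"
  using assms unfolding scatter_inv_def by simp blast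

lemma end_scatter_inv:
  assumes inv: "scatter_inv b c k {} s"
  shows "gather_inv b c (Suc k) {v. msgs s v \<noteq> {}} {} (s\<lparr> control := C, active := {} \<rparr>)"
proof -
  have cand: "\<And>v. msgs s v \<subseteq> candidates b c (Suc k) v"
    and lab: "lab s = labels_upto b c (Suc k)"
    using inv unfolding scatter_inv_def by blast+
  have sent: "labels_at b c (Suc k) v \<subseteq> msgs s v" for v
  proof
    fix x assume x: "x \<in> labels_at b c (Suc k) v"
    obtain u d where [simp]: "x = (u, d)" by (cases x)
    obtain a where a: "d = Suc k" "(a, v) \<in> arcs_ends G" "(u, k) \<in> labels_at b c k a" "\<pi> u < \<pi> v"
      using labels_at_pred[OF x[unfolded \<open>x = (u, d)\<close>]] by blast
    then have "(a, v, u, k) \<in> work_items b c k" by (simp add: work_items_def)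
    with inv a(4) have "(u, Suc k) \<in> msgs s v \<or> (\<exists>m\<le>k. wlk m u v)"
      unfolding scatter_inv_def by blast
    \<comment> \<open>The next layer has distance exactly \<open>Suc k\<close>, so no flag of an
      earlier iteration can have suppressed its messages.\<close>
    moreover have "\<not> wlk m u v" if "m \<le> k" for m
      using hub_atD(4)[of "Suc k" u v m] x that by (auto simp: labels_at_def)
    ultimately show "x \<in> msgs s v" using a(1) by auto
  qed
  have "labels_at b c (Suc k) v = {}" if "msgs s v = {}" for v
    using sent[of v] that by simp
  moreover have "\<exists>m\<le>Suc k. wlk m u v" if "u \<in> flagged s v" for u v
  proof -
    have "(u, Suc k) \<in> msgs s v \<or> (\<exists>m\<le>k. wlk m u v)"
      using inv that unfolding scatter_inv_def by blast
    moreover have "wlk (Suc k) u v" if "(u, Suc k) \<in> msgs s v"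
      using cand[of v] that unfolding candidates_def by blast
    ultimately show ?thesis by (meson le_SucI order_refl)
  qed
  moreover have "{v. msgs s v \<noteq> {}} \<subseteq> verts G"
    using cand candidates_in_verts by blast
  ultimately show ?thesis
    using cand lab sent unfolding gather_inv_def gather_at_def
    by (simp add: labels_upto_Suc[of b c "Suc k"])
qed

text \<open>A frame rule: the transition affects only \<open>v\<close>, so \<open>gather_at\<close>
  carries over at all other vertices.\<close>

lemma gather_step_inv:
  assumes inv: "gather_inv b c k W R s"
    and "flagged s' = flagged s" "W' \<inter> R' = {}" "W' \<union> R' \<subseteq> W \<union> R"
    and unchanged: "\<And>w. w \<noteq> v \<Longrightarrow> lab s' w = lab s w \<and> new_lab s' w = new_lab s w \<and>
      msgs s' w = msgs s w \<and> (w \<in> active s' \<longleftrightarrow> w \<in> active s) \<and>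
      (w \<in> W' \<longleftrightarrow> w \<in> W) \<and> (w \<in> R' \<longleftrightarrow> w \<in> R)"
    and changed: "gather_at b c k W' R' s' v"
  shows "gather_inv b c k W' R' s'"
proof -
  have "gather_at b c k W' R' s' w" for w
  proof (cases "w = v")
    case False
    have "gather_at b c k W R s w" using inv by (simp add: gather_inv_def)
    with unchanged[OF False] show ?thesis by (simp add: gather_at_def)
  qed (simp add: changed)
  moreover have "W' \<union> R' \<subseteq> verts G"
    using inv assms(4) unfolding gather_inv_def by blast
  ultimately show ?thesis using inv assms(2,3) by (simp add: gather_inv_def)
qed

lemma gather_start_inv:
  assumes inv: "gather_inv b c k W R s" and v: "v \<in> W"
  shows "gather_inv b c k (W - {v}) (insert v R) (s\<lparr> control := C, new_lab := (new_lab s)(v := {}) \<rparr>)"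
proof (rule gather_step_inv[OF inv, where v = v])
  have "gather_at b c k W R s v" using inv by (simp add: gather_inv_def)
  with v show "gather_at b c k (W - {v}) (insert v R)
      (s\<lparr> control := C, new_lab := (new_lab s)(v := {}) \<rparr>) v"
    by (simp add: gather_at_def)
  show "(W - {v}) \<inter> insert v R = {}" using inv by (auto simp: gather_inv_def)
qed (use v in auto)

lemma gather_lab_bounds:
  assumes "gather_inv b c k W R s"
  shows "labels_upto b c k v \<subseteq> lab s v" "lab s v \<subseteq> labels_upto b c (Suc k) v"
proof -
  have "gather_at b c k W R s v" using assms by (simp add: gather_inv_def)
  then have "lab s v = labels_upto b c k v \<or> lab s v = labels_upto b c (Suc k) v"
    unfolding gather_at_def by blast
  then show "labels_upto b c k v \<subseteq> lab s v" "lab s v \<subseteq> labels_upto b c (Suc k) v"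
    by (auto simp: labels_upto_Suc)
qed

lemma gather_message_inv:
  assumes inv: "gather_inv b c k W R s" and v: "v \<in> R" and msg: "(u, d) \<in> msgs s v"
  shows "gather_inv b c k W R
       (s\<lparr> msgs := (msgs s)(v := msgs s v - {(u, d)}),
          new_lab := (new_lab s)(v :=
            (if enat d < query (lab s u) (lab s v)
             then insert (u, d) (new_lab s v) else new_lab s v)) \<rparr>)" (is "gather_inv _ _ _ _ _ ?s'")
proof (rule gather_step_inv[OF inv, where v = v])
  have at: "gather_at b c k W R s v" and W: "v \<notin> W"
    using inv v by (auto simp: gather_inv_def)
  then have cand: "(u, d) \<in> candidates b c k v" and lab: "lab s v = labels_upto b c k v"
    using v msg unfolding gather_at_def by blast+
  then have d: "d = k" and
    u: "u \<in> verts G" "wlk k u v" "\<pi> u < \<pi> v" "b < \<pi> u" "\<pi> u \<le> c"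
    by (simp_all add: candidates_def)
  \<comment> \<open>The label of \<open>v\<close> is known exactly because \<open>v\<close> is in
    progress; for that of \<open>u\<close> only \<open>gather_lab_bounds\<close> is
    available.\<close>
  then have "enat k < query (lab s u) (lab s v) \<longleftrightarrow> hub_at k u v"
    unfolding lab by (intro distance_check_iff[OF u] gather_lab_bounds[OF inv])
  then have check: "enat d < query (lab s u) (lab s v) \<longleftrightarrow> (u, d) \<in> labels_at b c k v"
    using d u(4,5) by (simp add: labels_at_def)
  have at': "msgs s v \<subseteq> candidates b c k v" "v \<notin> active s"
    "new_lab s v \<subseteq> labels_at b c k v" "labels_at b c k v \<subseteq> msgs s v \<union> new_lab s v"
    using at v by (simp_all add: gather_at_def)
  have "msgs ?s' v \<subseteq> candidates b c k v" using at'(1) by auto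
  moreover have "new_lab ?s' v \<subseteq> labels_at b c k v" using at'(3) check by auto
  moreover have "labels_at b c k v \<subseteq> msgs ?s' v \<union> new_lab ?s' v" using at'(4) check by auto
  ultimately show "gather_at b c k W R ?s' v"
    using v W lab at'(2) by (simp add: gather_at_def)
  show "W \<inter> R = {}" using inv by (simp add: gather_inv_def)
qed auto

lemma gather_finish_inv:
  assumes inv: "gather_inv b c k W R s" and v: "v \<in> R" and msg: "msgs s v = {}"
  shows "gather_inv b c k W (R - {v})
       (if new_lab s v \<noteq> {}
        then s\<lparr> control := C,
               lab := (lab s)(v := lab s v \<union> new_lab s v),
               active := insert v (active s) \<rparr>
        else s\<lparr> control := C \<rparr>)" (is "gather_inv _ _ _ _ _ ?s'")
proof (rule gather_step_inv[OF inv, where v = v])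
  have at: "gather_at b c k W R s v" and W: "v \<notin> W"
    using inv v by (auto simp: gather_inv_def)
  \<comment> \<open>With no message left, the two inclusions for vertices in \<open>R\<close> give
    equality.\<close>
  have new: "new_lab s v = labels_at b c k v" and lab: "lab s v = labels_upto b c k v"
    and act: "v \<notin> active s"
    using at v msg unfolding gather_at_def by blast+
  show "gather_at b c k W (R - {v}) ?s' v"
    using W msg act by (simp add: gather_at_def labels_upto_Suc new lab)
  show "W \<inter> (R - {v}) = {}" using inv by (auto simp: gather_inv_def)
qed auto

lemma end_gather_inv:
  "gather_inv b c k {} {} s \<Longrightarrow> while_inv b c k (s\<lparr> control := C \<rparr>)"
  unfolding gather_inv_def gather_at_def while_inv_def by (auto simp: fun_eq_iff)

lemma batch_eq:
  "batch G \<pi> T i = {v \<in> verts G. rank_bound T (i - 1) < \<pi> v \<and> \<pi> v \<le> rank_bound T i}"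
  by (auto simp: batch_def)

text \<open>The bound before the first batch is 0 and ranks start at 1, so empty labels are
  complete.\<close>

lemma bvc_pll_inv_init: "bvc_pll_inv T init_state"
  using rank_pos by (force simp: bvc_pll_inv_def init_state_def labels_upto_def dest: hub_atD(1))

lemma bvc_pll_inv_step:
  assumes "bvc_pll_step G \<pi> T s s'" "bvc_pll_inv T s" "0 < T"
  shows "bvc_pll_inv T s'"
  using assms
proof (cases rule: bvc_pll_step.cases)
  case (begin_batch i)
  with assms(2) have i: "1 \<le> i" "i \<le> T" and "flagged s = (\<lambda>_. {})"
    and "lab s = labels_upto (rank_bound T (i - 1)) (rank_bound T (i - 1)) 0"
    by (auto simp: bvc_pll_inv_def)
  then have "while_inv (rank_bound T (i - 1)) (rank_bound T i) 0 s'"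
    unfolding begin_batch(1) by (intro begin_batch_inv batch_eq)
  moreover have "control s' = While i" using begin_batch(1) by simp
  ultimately show ?thesis using i by (auto simp: bvc_pll_inv_def)
next
  case (halt i)
  with assms(2) have "i = T + 1" by (simp add: bvc_pll_inv_def)
  with halt assms(2) have lab: "lab s = labels_upto (rank_bound T T) (rank_bound T T) 0"
    by (simp add: bvc_pll_inv_def)
  \<comment> \<open>After the last batch the bound is the largest rank, so every canonical pair is
    covered.\<close>
  have "rank_bound T T = card (verts G)" using assms(3) by simp
  then have "lab s = (\<lambda>v. {(h, d). hub_at d h v})"
    unfolding lab labels_upto_def using rank_le_card[OF hub_atD(1)] by (auto simp: fun_eq_iff)
  with halt show ?thesis by (simp add: bvc_pll_inv_def)
next
  case (begin_iteration i)
  with assms(2) obtain k where "1 \<le> i" "i \<le> T"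
    and k: "while_inv (rank_bound T (i - 1)) (rank_bound T i) k s"
    by (auto simp: bvc_pll_inv_def)
  with begin_iteration_inv[OF k, of "control s'"] begin_iteration(1) show ?thesis
    by (auto simp: bvc_pll_inv_def)
next
  case (end_batch i)
  with assms(2) obtain k where i: "1 \<le> i" "i \<le> T"
    and k: "while_inv (rank_bound T (i - 1)) (rank_bound T i) k s"
    by (auto simp: bvc_pll_inv_def)
  have "rank_bound T (i - 1) \<le> rank_bound T i" by (intro div_le_mono mult_le_mono1) simp
  from end_batch_inv[OF k end_batch(3) this] i end_batch(1) show ?thesis
    by (simp add: bvc_pll_inv_def)
next
  case (scatter_send i W a v u d)
  with assms(2) obtain k where "1 \<le> i" "i \<le> T"
    and k: "scatter_inv (rank_bound T (i - 1)) (rank_bound T i) k W s"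
    by (auto simp: bvc_pll_inv_def)
  with scatter_send_inv[OF k scatter_send(3), of "control s'"] scatter_send(1,4) show ?thesis
    by (auto simp: bvc_pll_inv_def)
next
  case (scatter_skip i W a v u d)
  with assms(2) obtain k where "1 \<le> i" "i \<le> T"
    and k: "scatter_inv (rank_bound T (i - 1)) (rank_bound T i) k W s"
    by (auto simp: bvc_pll_inv_def)
  with scatter_skip_inv[OF k scatter_skip(4), of a d "control s'"] scatter_skip(1) show ?thesis
    by (auto simp: bvc_pll_inv_def)
next
  case (end_scatter i)
  with assms(2) obtain k where "1 \<le> i" "i \<le> T"
    and k: "scatter_inv (rank_bound T (i - 1)) (rank_bound T i) k {} s"
    by (auto simp: bvc_pll_inv_def)
  with end_scatter_inv[OF k, of "control s'"] end_scatter(1) show ?thesis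
    by (auto simp: bvc_pll_inv_def)
next
  case (gather_start i W R v)
  with assms(2) obtain k where "1 \<le> i" "i \<le> T"
    and k: "gather_inv (rank_bound T (i - 1)) (rank_bound T i) k W R s"
    by (auto simp: bvc_pll_inv_def)
  with gather_start_inv[OF k gather_start(3), of "control s'"] gather_start(1) show ?thesis
    by (auto simp: bvc_pll_inv_def)
next
  case (gather_message i W R v u d)
  with assms(2) obtain k where "1 \<le> i" "i \<le> T"
    "gather_inv (rank_bound T (i - 1)) (rank_bound T i) k W R s"
    by (auto simp: bvc_pll_inv_def)
  with gather_message_inv[OF this(3) gather_message(3,4)] gather_message(1,2) show ?thesis
    by (auto simp: bvc_pll_inv_def)
next
  case (gather_finish i W R v)
  with assms(2) obtain k where k: "1 \<le> i" "i \<le> T"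
    "gather_inv (rank_bound T (i - 1)) (rank_bound T i) k W R s"
    by (auto simp: bvc_pll_inv_def)
  have "control s' = Gather i W (R - {v})" using gather_finish(1) by simp
  moreover have "gather_inv (rank_bound T (i - 1)) (rank_bound T i) k W (R - {v}) s'"
    unfolding gather_finish(1) using k(3) gather_finish(3,4) by (rule gather_finish_inv)
  ultimately show ?thesis using k(1,2) by (auto simp: bvc_pll_inv_def)
next
  case (end_gather i)
  with assms(2) obtain k where "1 \<le> i" "i \<le> T"
    and k: "gather_inv (rank_bound T (i - 1)) (rank_bound T i) k {} {} s"
    by (auto simp: bvc_pll_inv_def)
  with end_gather_inv[OF k, of "control s'"] end_gather(1) show ?thesis
    by (auto simp: bvc_pll_inv_def)
qed

end

section \<open>Termination\<close>

lemma bvc_pll_step_exists: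
  assumes "control s \<noteq> Halt"
  shows "\<exists>s'. bvc_pll_step G \<pi> T s s'"
proof (cases "control s")
  case (Batch i)
  then show ?thesis by (cases "i \<le> T") (blast intro: bvc_pll_step.intros)+
next
  case (While i)
  then show ?thesis by (cases "active s = {}") (blast intro: bvc_pll_step.intros)+
next
  case (Scatter i W)
  show ?thesis
  proof (cases "W = {}")
    case True
    with Scatter show ?thesis by (blast intro: bvc_pll_step.end_scatter)
  next
    case False
    then obtain a v u d where x: "(a, v, u, d) \<in> W" by auto
    show ?thesis
    proof (cases "\<pi> u < \<pi> v \<and> u \<notin> flagged s v")
      case True
      from bvc_pll_step.scatter_send[OF Scatter x this] show ?thesis ..
    next
      case False
      from bvc_pll_step.scatter_skip[OF Scatter x this] show ?thesis ..
    qed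
  qed
next
  case (Gather i W R)
  consider v where "v \<in> W" | v u d where "v \<in> R" "(u, d) \<in> msgs s v"
    | v where "v \<in> R" "msgs s v = {}" | "W = {}" "R = {}"
    by (metis all_not_in_conv surj_pair)
  then show ?thesis
  proof cases
    case 1
    from bvc_pll_step.gather_start[OF Gather this] show ?thesis ..
  next
    case 2
    from bvc_pll_step.gather_message[OF Gather this] show ?thesis ..
  next
    case 3
    from bvc_pll_step.gather_finish[OF Gather this] show ?thesis ..
  next
    case 4
    with Gather show ?thesis by (blast intro: bvc_pll_step.end_gather)
  qed
qed (use assms in simp)

text \<open>The factor 2 makes room for \<open>Batch i\<close>, \<open>While i\<close>,
  \<open>Batch (i + 1)\<close> to descend by one each; \<open>Batch (T + 1)\<close> is still above
  \<open>Halt\<close>.\<close>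

fun phases_left :: "nat \<Rightarrow> 'a control \<Rightarrow> nat" where
  "phases_left T (Batch i) = 2 * (T + 1 - i) + 1"
| "phases_left T (While i) = 2 * (T + 1 - i)"
| "phases_left T (Scatter i W) = 2 * (T + 1 - i)"
| "phases_left T (Gather i W R) = 2 * (T + 1 - i)"
| "phases_left T Halt = 0"

text \<open>Flags only grow within a batch; their reset at its end is paid for by
  \<open>phases_left\<close>.\<close>

definition unflagged_pairs :: "'a set \<Rightarrow> 'a state \<Rightarrow> nat" where
  "unflagged_pairs V s = card {(u, v). u \<in> V \<and> v \<in> V \<and> u \<notin> flagged s v}"

text \<open>
  A sent message raises \<open>phase_rank\<close> from 2 to 5, but its flag decreases \<open>unflagged_pairs\<close>, which
  comes first in the lexicographic measure. An iteration that sends nothing descends through the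
  ranks 3, 2, 1, 0.
\<close>

definition phase_rank :: "'a state \<Rightarrow> nat" where
  "phase_rank s = (case control s of
      While i \<Rightarrow> if active s = {} then 0 else 3
    | Scatter i W \<Rightarrow> if \<forall>v. msgs s v = {} then 2 else 5
    | Gather i W R \<Rightarrow> if W = {} \<and> R = {} \<and> active s = {} then 1 else 4
    | _ \<Rightarrow> 0)"

text \<open>Weight 2 for waiting vertices lets the move from \<open>W\<close> to \<open>R\<close>
  count as progress.\<close>

definition work_left :: "'a set \<Rightarrow> 'a state \<Rightarrow> nat" where
  "work_left V s = (case control s of
      Scatter i W \<Rightarrow> card W
    | Gather i W R \<Rightarrow> 2 * card W + card R + (\<Sum>v\<in>V. card (msgs s v))
    | _ \<Rightarrow> 0)"

lemma unflagged_pairs_less: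
  assumes "finite V" "u \<in> V" "v \<in> V" "u \<notin> flagged s v"
    "flagged s' = (flagged s)(v := insert u (flagged s v))"
  shows "unflagged_pairs V s' < unflagged_pairs V s"
  unfolding unflagged_pairs_def
proof (rule psubset_card_mono)
  show "finite {(u, v). u \<in> V \<and> v \<in> V \<and> u \<notin> flagged s v}"
    by (rule finite_subset[of _ "V \<times> V"]) (use assms(1) in auto)
  have "(u, v) \<notin> {(u, v). u \<in> V \<and> v \<in> V \<and> u \<notin> flagged s' v}"
    "(u, v) \<in> {(u, v). u \<in> V \<and> v \<in> V \<and> u \<notin> flagged s v}"
    using assms by auto
  moreover have "{(u, v). u \<in> V \<and> v \<in> V \<and> u \<notin> flagged s' v}
      \<subseteq> {(u, v). u \<in> V \<and> v \<in> V \<and> u \<notin> flagged s v}"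
    using assms(5) by (auto split: if_splits)
  ultimately show "{(u, v). u \<in> V \<and> v \<in> V \<and> u \<notin> flagged s' v}
      \<subset> {(u, v). u \<in> V \<and> v \<in> V \<and> u \<notin> flagged s v}"
    by blast
qed

context ranked_graph
begin

abbreviation bvc_pll_measure :: "nat \<Rightarrow> ('a state \<times> 'a state) set" where
  "bvc_pll_measure T \<equiv> measures [\<lambda>s. phases_left T (control s), unflagged_pairs (verts G), phase_rank,
     work_left (verts G)]"

lemma work_items_in_verts:
  assumes "(a, v, u, d) \<in> work_items b c k"
  shows "a \<in> verts G" "v \<in> verts G" "u \<in> verts G" "d = k"
  using assms adj_in_verts[of a v] hub_atD(1)
  unfolding work_items_def labels_at_def by blast+

lemma finite_work_items: "finite (work_items b c k)"
  by (rule finite_subset[of _ "verts G \<times> verts G \<times> verts G \<times> {k}"])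
    (auto dest: work_items_in_verts)

text \<open>The invariant supplies finiteness of the work sets and confines them to vertices, so
  that the cardinalities really drop.\<close>

lemma bvc_pll_measure_step:
  assumes "bvc_pll_step G \<pi> T s s'" "bvc_pll_inv T s"
  shows "(s', s) \<in> bvc_pll_measure T"
  using assms
proof (cases rule: bvc_pll_step.cases)
  case (begin_batch i)
  then show ?thesis by simp
next
  case (halt i)
  then show ?thesis by simp
next
  case (begin_iteration i)
  then show ?thesis by (simp add: unflagged_pairs_def phase_rank_def)
next
  case (end_batch i)
  \<comment> \<open>This keeps the truncated subtraction in \<open>phases_left\<close> strictly
    decreasing.\<close>
  with assms(2) have "i \<le> T" by (simp add: bvc_pll_inv_def)
  with end_batch(1,2) show ?thesis by (simp add: Suc_diff_le)
next
  case (scatter_send i W a v u d)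
  with assms(2) obtain b c k where "W \<subseteq> work_items b c k"
    by (auto simp: bvc_pll_inv_def scatter_inv_def)
  with scatter_send(3) have "(a, v, u, d) \<in> work_items b c k" by blast
  then have "u \<in> verts G" "v \<in> verts G" by (rule work_items_in_verts)+
  with scatter_send(1,4) have "unflagged_pairs (verts G) s' < unflagged_pairs (verts G) s"
    by (intro unflagged_pairs_less[of _ u v]) simp_all
  moreover have "phases_left T (control s') = phases_left T (control s)"
    using scatter_send(1,2) by simp
  ultimately show ?thesis by simp
next
  case (scatter_skip i W a v u d)
  with assms(2) obtain b c k where "W \<subseteq> work_items b c k"
    by (auto simp: bvc_pll_inv_def scatter_inv_def)
  then have "finite W" using finite_work_items by (rule finite_subset)
  then have "card (W - {(a, v, u, d)}) < card W" using scatter_skip(3) by (rule card_Diff1_less)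
  with scatter_skip(1,2) show ?thesis
    by (simp add: unflagged_pairs_def phase_rank_def work_left_def)
next
  case (end_scatter i)
  then show ?thesis by (simp add: unflagged_pairs_def phase_rank_def)
next
  case (gather_start i W R v)
  with assms(2) obtain b c k where inv: "gather_inv b c k W R s"
    by (auto simp: bvc_pll_inv_def)
  then have "W \<union> R \<subseteq> verts G" by (simp add: gather_inv_def)
  then have fin: "finite W" "finite R" by (auto intro: finite_subset)
  have "card W = Suc (card (W - {v}))" using card_Suc_Diff1[OF fin(1) gather_start(3)] by simp
  moreover have "card (insert v R) \<le> Suc (card R)" using fin(2) by (simp add: card_insert_if)
  ultimately have "work_left (verts G) s' < work_left (verts G) s"
    using gather_start(1,2) by (simp add: work_left_def)
  moreover have "phase_rank s' = phase_rank s"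
    using gather_start(1,2,3) by (auto simp: phase_rank_def)
  ultimately show ?thesis
    using gather_start(1,2) by (simp add: unflagged_pairs_def)
next
  case (gather_message i W R v u d)
  with assms(2) obtain b c k where inv: "gather_inv b c k W R s"
    by (auto simp: bvc_pll_inv_def)
  then have v: "v \<in> verts G" and "msgs s v \<subseteq> candidates b c k v"
    using gather_message(3) by (auto simp: gather_inv_def gather_at_def)
  from this(2) have "finite (msgs s v)" using finite_candidates by (rule finite_subset)
  then have "card (msgs s v - {(u, d)}) < card (msgs s v)"
    using gather_message(4) by (rule card_Diff1_less)
  then have "(\<Sum>w\<in>verts G. card (msgs s' w)) < (\<Sum>w\<in>verts G. card (msgs s w))"
    using v gather_message(1) by (intro sum_strict_mono_ex1) auto
  then have "work_left (verts G) s' < work_left (verts G) s"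
    using gather_message(1,2) by (simp add: work_left_def)
  then show ?thesis
    using gather_message(1,2) by (simp add: unflagged_pairs_def phase_rank_def)
next
  case (gather_finish i W R v)
  with assms(2) obtain b c k where inv: "gather_inv b c k W R s"
    by (auto simp: bvc_pll_inv_def)
  then have "W \<union> R \<subseteq> verts G" by (simp add: gather_inv_def)
  then have "finite R" by (auto intro: finite_subset)
  then have "card (R - {v}) < card R" using gather_finish(3) by (rule card_Diff1_less)
  then have "work_left (verts G) s' < work_left (verts G) s"
    using gather_finish(1,2) by (simp add: work_left_def)
  \<comment> \<open>The rank falls from 4 to 1 if the last vertex finishes with nothing active;
    otherwise it stays.\<close>
  moreover have "phase_rank s' \<le> phase_rank s"
    using gather_finish(1,2,3) by (auto simp: phase_rank_def)
  moreover have "unflagged_pairs (verts G) s' = unflagged_pairs (verts G) s"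
    "phases_left T (control s') = phases_left T (control s)"
    using gather_finish(1,2) by (simp_all add: unflagged_pairs_def)
  ultimately show ?thesis by auto
next
  case (end_gather i)
  then show ?thesis by (simp add: unflagged_pairs_def phase_rank_def)
qed

section \<open>Total correctness\<close>

lemma bvc_pll_reachable_inv:
  assumes "bvc_pll_reachable G \<pi> T s" "0 < T"
  shows "bvc_pll_inv T s"
  using assms(1) unfolding bvc_pll_reachable_def
  by (induction rule: rtranclp_induct) (auto intro: bvc_pll_inv_init bvc_pll_inv_step assms(2))

lemma bvc_pll_terminates:
  assumes "0 < T"
  shows "bvc_pll_terminates G \<pi> T"
proof -
  have False if r: "r 0 = init_state" "\<And>n. bvc_pll_step G \<pi> T (r n) (r (Suc n))" for r
  proof -
    have inv: "bvc_pll_inv T (r n)" for n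
      by (induction n) (simp add: r(1) bvc_pll_inv_init, rule bvc_pll_inv_step[OF r(2) _ assms])
    have "(r (Suc n), r n) \<in> bvc_pll_measure T" for n
      using r(2) inv by (rule bvc_pll_measure_step)
    moreover have "wf (bvc_pll_measure T)" by (rule wf_measures)
    ultimately show False unfolding wf_iff_no_infinite_down_chain by blast
  qed
  then show ?thesis
    unfolding bvc_pll_terminates_def using bvc_pll_step_exists by blast
qed

lemma bvc_pll_output_canonical:
  assumes "bvc_pll_output G \<pi> T L" "0 < T"
  shows "u \<in> hubs (L v) \<longleftrightarrow> u \<in> canonical_hhl G \<pi> v"
proof -
  obtain s where "bvc_pll_reachable G \<pi> T s" and s: "control s = Halt" "L = lab s"
    using assms(1) unfolding bvc_pll_output_def by blast
  then have "bvc_pll_inv T s" using assms(2) bvc_pll_reachable_inv by blast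
  with s have "L v = {(h, d). hub_at d h v}" by (simp add: bvc_pll_inv_def)
  then show ?thesis by (force simp: hubs_def canonical_hhl_iff)
qed

end

theorem mainTheorem2:
  fixes G :: "('a, 'b) pre_digraph" and \<pi> :: "'a \<Rightarrow> nat" and T :: nat
  assumes "graph G"
    and "bij_betw \<pi> (verts G) {1..card (verts G)}"
    and "0 < T" and "T dvd card (verts G)"
  shows "bvc_pll_terminates G \<pi> T \<and>
    (\<forall>L. bvc_pll_output G \<pi> T L \<longrightarrow>
      (\<forall>u \<in> verts G. \<forall>v \<in> verts G. u \<in> hubs (L v) \<longleftrightarrow> u \<in> canonical_hhl G \<pi> v))"
proof -
  interpret graph G by fact
  interpret ranked_graph G \<pi> by unfold_locales fact
  show ?thesis using bvc_pll_terminates bvc_pll_output_canonical assms(3) by blast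
qed

end
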